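(* Let $X$ be a Banach space, $U:\Delta\to\mathcal{B}(X)$ an evolution operator on $X$, $h,k:\mathbb{R}_+\to[1,\infty)$ two growth rates, and $P:\mathbb{R}_+\to\mathcal{B}(X)$ a family of projectors compatible with $U$, with complementary family $Q$. Then the pair $(U,P)$ is $(h,k)$-dichotomic if and only if there exists a family of norms $\mathcal{N}_1=\{|||\cdot|||_t,\ t\geq 0\}$ on $X$ compatible with the family of projectors $P$ such that $$h(t)\,|||U(t,s)P(s)x|||_t\leq h(s)\,|||P(s)x|||_s$$ and $$k(t)\,|||V(t,s)Q(t)x|||_s\leq k(s)\,|||Q(t)x|||_t$$ for all $(t,s,x)\in\Delta\times X$.
   Context: Notation: $X$ is a Banach space with norm $\|\cdot\|$, $\mathcal{B}(X)$ is the Banach algebra of bounded linear operators on $X$, $\mathbb{R}_+=[0,\infty)$, and $\Delta=\{(t,s)\in\mathbb{R}_+^2: t\geq s\geq 0\}$. An evolution operator on $X$ is a map $U:\Delta\to\mathcal{B}(X)$ with $U(t,t)=I$ for all $t\ge 0$ and $U(t,t_0)=U(t,s)U(s,t_0)$ for all $(t,s),(s,t_0)\in\Delta$ (no continuity in $(t,s)$ is assumed). A family of projectors is a map $P:\mathbb{R}_+\to\mathcal{B}(X)$ with $P(t)^2=P(t)$ for all $t\geq0$; its complementary family is $Q(t)=I-P(t)$. $P$ is invariant for $U$ if $U(t,s)P(s)x=P(t)U(t,s)x$ for all $(t,s,x)\in\Delta\times X$. $P$ is compatible with $U$ if it is invariant for $U$ and for every $(t,s)\in\Delta$ the restriction of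 $U(t,s)$ to $\operatorname{Ker}P(s)$ is an isomorphism from $\operatorname{Ker}P(s)$ onto $\operatorname{Ker}P(t)$. In that case $V(t,s)$ denotes the inverse isomorphism from $\operatorname{Ker}P(t)=\operatorname{Range}Q(t)$ to $\operatorname{Ker}P(s)=\operatorname{Range}Q(s)$, so that $U(t,s)V(t,s)Q(t)x=Q(t)x$, $V(t,s)U(t,s)Q(s)x=Q(s)x$ and $V(t,s)Q(t)x=Q(s)V(t,s)Q(t)x$ for all $(t,s,x)\in\Delta\times X$. A growth rate is a nondecreasing map $h:\mathbb{R}_+\to[1,\infty)$ with $\lim_{t\to\infty}h(t)=\infty$. The pair $(U,P)$ (with $P$ invariant for $U$) is (nonuniformly) $(h,k)$-dichotomic if there exists a nondecreasing map $N:\mathbb{R}_+\to[1,\infty)$ such that for all $(t,s,x)\in\Delta\times X$: $h(t)\|U(t,s)P(s)x\|\leq N(s)h(s)\|P(s)x\|$ and $k(t)\|Q(s)x\|\leq N(t)k(s)\|U(t,s)Q(s)x\|$. A family of norms $\{\|\cdot\|_t,\ t\geq0\}$ on $X$ is compatible with the family of projectors $P$ if there exists a nondecreasing map $N:\mathbb{R}_+\to[1,\infty)$ such that $\|x\|\leq\|x\|_t\leq N(t)(\|P(t)x\|+\|Q(t)x\|)$ for all $(t,x)\in\mathbb{R}_+\times X$. *)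

theory Defs
  imports "HOL-Analysis.Analysis"
begin

text \<open>
  Functions on \<open>[0,\<infinity>)\<close> and on \<open>{(t,s). 0 \<le> s \<le> t}\<close> are total functions on \<open>real\<close>; every
  definition constrains and uses their values only on the intended domain.
\<close>

definition evolution_operator ::
    "(real \<Rightarrow> real \<Rightarrow> ('a::banach) \<Rightarrow>\<^sub>L 'a) \<Rightarrow> bool" where
  "evolution_operator U \<longleftrightarrow>
     (\<forall>t\<ge>0. U t t = id_blinfun) \<and>
     (\<forall>t s t0. 0 \<le> t0 \<and> t0 \<le> s \<and> s \<le> t \<longrightarrow> U t t0 = U t s o\<^sub>L U s t0)"

definition projector_family :: "(real \<Rightarrow> ('a::banach) \<Rightarrow>\<^sub>L 'a) \<Rightarrow> bool" where
  "projector_family P \<longleftrightarrow> (\<forall>t\<ge>0. P t o\<^sub>L P t = P t)"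

definition complementary ::
    "(real \<Rightarrow> ('a::banach) \<Rightarrow>\<^sub>L 'a) \<Rightarrow> real \<Rightarrow> 'a \<Rightarrow>\<^sub>L 'a" where
  "complementary P t = id_blinfun - P t"

definition blinfun_ker :: "(('a::banach) \<Rightarrow>\<^sub>L 'a) \<Rightarrow> 'a set" where
  "blinfun_ker A = {x. blinfun_apply A x = 0}"

definition invariant_for ::
    "(real \<Rightarrow> ('a::banach) \<Rightarrow>\<^sub>L 'a) \<Rightarrow> (real \<Rightarrow> real \<Rightarrow> 'a \<Rightarrow>\<^sub>L 'a) \<Rightarrow> bool" where
  "invariant_for P U \<longleftrightarrow>
     (\<forall>t s x. 0 \<le> s \<and> s \<le> t \<longrightarrow> U t s (P s x) = P t (U t s x))"

text \<open>
  As \<open>U t s\<close> is linear, its restriction to the kernel of \<open>P s\<close> is an isomorphism of normed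
  spaces onto the kernel of \<open>P t\<close> iff it is a homeomorphism between them.
\<close>

definition compatible_with ::
    "(real \<Rightarrow> ('a::banach) \<Rightarrow>\<^sub>L 'a) \<Rightarrow> (real \<Rightarrow> real \<Rightarrow> 'a \<Rightarrow>\<^sub>L 'a) \<Rightarrow> bool" where
  "compatible_with P U \<longleftrightarrow>
     invariant_for P U \<and>
     (\<forall>t s. 0 \<le> s \<and> s \<le> t \<longrightarrow>
        (\<exists>g. homeomorphism (blinfun_ker (P s)) (blinfun_ker (P t)) (blinfun_apply (U t s)) g))"

text \<open>
  The inverse \<open>V(t,s)\<close> of the restriction of \<open>U t s\<close> to the kernel of \<open>P s\<close>; meaningful only on
  the kernel of \<open>P t\<close>.
\<close>

definition inverse_evolution ::
    "(real \<Rightarrow> real \<Rightarrow> ('a::banach) \<Rightarrow>\<^sub>L 'a) \<Rightarrow> (real \<Rightarrow> 'a \<Rightarrow>\<^sub>L 'a) \<Rightarrow> real \<Rightarrow> real \<Rightarrow> 'a \<Rightarrow> 'a" where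
  "inverse_evolution U P t s = inv_into (blinfun_ker (P s)) (blinfun_apply (U t s))"

definition nondecreasing_ge1 :: "(real \<Rightarrow> real) \<Rightarrow> bool" where
  "nondecreasing_ge1 N \<longleftrightarrow> mono_on {0..} N \<and> (\<forall>t\<ge>0. 1 \<le> N t)"

definition growth_rate :: "(real \<Rightarrow> real) \<Rightarrow> bool" where
  "growth_rate h \<longleftrightarrow> nondecreasing_ge1 h \<and> filterlim h at_top at_top"

definition dichotomic ::
    "(real \<Rightarrow> real) \<Rightarrow> (real \<Rightarrow> real) \<Rightarrow>
     (real \<Rightarrow> real \<Rightarrow> ('a::banach) \<Rightarrow>\<^sub>L 'a) \<Rightarrow> (real \<Rightarrow> 'a \<Rightarrow>\<^sub>L 'a) \<Rightarrow> bool" where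
  "dichotomic h k U P \<longleftrightarrow>
     invariant_for P U \<and>
     (\<exists>N. nondecreasing_ge1 N \<and>
       (\<forall>t s x. 0 \<le> s \<and> s \<le> t \<longrightarrow>
          h t * norm (U t s (P s x)) \<le> N s * h s * norm (P s x) \<and>
          k t * norm (complementary P s x) \<le> N t * k s * norm (U t s (complementary P s x))))"

definition is_norm :: "(('a::real_vector) \<Rightarrow> real) \<Rightarrow> bool" where
  "is_norm n \<longleftrightarrow>
     (\<forall>x. 0 \<le> n x) \<and>
     (\<forall>x. n x = 0 \<longleftrightarrow> x = 0) \<and>
     (\<forall>c x. n (c *\<^sub>R x) = \<bar>c\<bar> * n x) \<and>
     (\<forall>x y. n (x + y) \<le> n x + n y)"

definition norm_family :: "(real \<Rightarrow> ('a::real_vector) \<Rightarrow> real) \<Rightarrow> bool" where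
  "norm_family nrm \<longleftrightarrow> (\<forall>t\<ge>0. is_norm (nrm t))"

definition norms_compatible_with ::
    "(real \<Rightarrow> ('a::banach) \<Rightarrow> real) \<Rightarrow> (real \<Rightarrow> 'a \<Rightarrow>\<^sub>L 'a) \<Rightarrow> bool" where
  "norms_compatible_with nrm P \<longleftrightarrow>
     (\<exists>N. nondecreasing_ge1 N \<and>
       (\<forall>t x. 0 \<le> t \<longrightarrow>
          norm x \<le> nrm t x \<and>
          nrm t x \<le> N t * (norm (P t x) + norm (complementary P t x))))"

lemma complementary_in_ker:
  assumes "projector_family P" "0 \<le> t"
  shows "blinfun_apply (complementary P t) x \<in> blinfun_ker (P t)"
proof -
  have "blinfun_apply (P t) (P t x) = P t x"
    using assms unfolding projector_family_def by (metis blinfun_apply_blinfun_compose)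
  then show ?thesis
    by (simp add: blinfun_ker_def complementary_def blinfun.diff_left blinfun.diff_right)
qed

lemma inverse_evolution_identities:
  assumes "projector_family P" "compatible_with P U" "0 \<le> s" "s \<le> t"
  shows "U t s (inverse_evolution U P t s (complementary P t x)) = complementary P t x"
    and "inverse_evolution U P t s (U t s (complementary P s x)) = complementary P s x"
    and "inverse_evolution U P t s (complementary P t x) =
           complementary P s (inverse_evolution U P t s (complementary P t x))"
proof -
  obtain g where g: "homeomorphism (blinfun_ker (P s)) (blinfun_ker (P t)) (U t s) g"
    using assms unfolding compatible_with_def by blast
  have img: "blinfun_apply (U t s) ` blinfun_ker (P s) = blinfun_ker (P t)"
    using g by (simp add: homeomorphism_def)
  have inj: "inj_on (U t s) (blinfun_ker (P s))"
    using g by (auto simp: homeomorphism_def intro: inj_on_inverseI)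
  have Qt: "complementary P t x \<in> blinfun_apply (U t s) ` blinfun_ker (P s)"
    using complementary_in_ker[OF assms(1)] assms img by force
  show "U t s (inverse_evolution U P t s (complementary P t x)) = complementary P t x"
    unfolding inverse_evolution_def using Qt by (rule f_inv_into_f)
  show "inverse_evolution U P t s (U t s (complementary P s x)) = complementary P s x"
    unfolding inverse_evolution_def
    using inj complementary_in_ker[OF assms(1,3)] by (rule inv_into_f_f)
  have "inverse_evolution U P t s (complementary P t x) \<in> blinfun_ker (P s)"
    unfolding inverse_evolution_def using Qt by (rule inv_into_into)
  then show "inverse_evolution U P t s (complementary P t x) =
      complementary P s (inverse_evolution U P t s (complementary P t x))"
    by (simp add: blinfun_ker_def complementary_def blinfun.diff_left)
qed

end

theory Submission
  imports Defs
begin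

text \<open>
  A nonuniform dichotomy becomes a uniform one, with constant 1, once each point is measured by its
  whole weighted trajectory. Along the stable part only the future matters and along the unstable
  part, where the evolution is invertible, only the past; so the right norm at time \<open>t\<close> is
    \<open>|||x|||(t) = (SUP \<tau>\<ge>t. h(\<tau>)/h(t) \<parallel>U(\<tau>,t)P(t)x\<parallel>) + (SUP r\<in>[0,t]. k(t)/k(r) \<parallel>V(t,r)Q(t)x\<parallel>)\<close>.
  The two dichotomy estimates say exactly that these suprema are at most \<open>N(t) \<parallel>P(t) x\<parallel>\<close> and
  \<open>N(t) \<parallel>Q(t) x\<parallel>\<close>, which is compatibility with \<open>P\<close> (\<open>stable_seminorm_le\<close>,
  \<open>unstable_seminorm_le\<close>); the values at \<open>\<tau> = t\<close> and \<open>r = t\<close> give \<open>\<parallel>x\<parallel> \<le> |||x|||(t)\<close>.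
  By the cocycle laws for \<open>U\<close> and \<open>V\<close>, moving forward on the range of \<open>P\<close>, or backward on the
  range of \<open>Q\<close>, only shrinks the index set of the supremum and rescales the weights, whence the
  contraction estimates (\<open>stable_seminorm_contracts\<close>, \<open>unstable_seminorm_contracts\<close>).

  Conversely, on the ranges of \<open>P(t)\<close> and \<open>Q(t)\<close> one of the two terms of the compatibility bound
  vanishes, so there \<open>|||\<cdot>|||(t)\<close> lies between \<open>\<parallel>\<cdot>\<parallel>\<close> and \<open>N(t) \<parallel>\<cdot>\<parallel>\<close>, and the contraction estimates
  turn into the dichotomy estimates with the same \<open>N\<close>.
\<close>

section \<open>Suprema of seminorms\<close>

definition seminorm :: "('a::real_vector \<Rightarrow> real) \<Rightarrow> bool" where
  "seminorm p \<longleftrightarrow> (\<forall>c x. p (c *\<^sub>R x) = \<bar>c\<bar> * p x) \<and> (\<forall>x y. p (x + y) \<le> p x + p y)"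

text \<open>Scaling by \<open>c\<close> and by its inverse gives the two halves of homogeneity.\<close>

lemma seminormI_le:
  assumes scale: "\<And>c x. p (c *\<^sub>R x) \<le> \<bar>c\<bar> * p x"
    and add: "\<And>x y. p (x + y) \<le> p x + p y"
  shows "seminorm p"
proof -
  have p0: "p 0 = 0"
    using scale[of 0 0] add[of 0 0] by simp
  have "\<bar>c\<bar> * p x \<le> p (c *\<^sub>R x)" for c x
  proof (cases "c = 0")
    case False
    then have "p x \<le> inverse \<bar>c\<bar> * p (c *\<^sub>R x)"
      using scale[of "inverse c" "c *\<^sub>R x"] by simp
    with False show ?thesis
      by (simp add: field_simps)
  qed (simp add: p0)
  then show ?thesis
    unfolding seminorm_def using scale add by (auto intro: antisym)
qed

lemma seminorm_SUP:
  fixes p :: "'i \<Rightarrow> 'a::real_vector \<Rightarrow> real"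
  assumes "I \<noteq> {}" and sn: "\<And>i. i \<in> I \<Longrightarrow> seminorm (p i)"
    and bdd: "\<And>x. bdd_above ((\<lambda>i. p i x) ` I)"
  shows "seminorm (\<lambda>x. SUP i\<in>I. p i x)"
proof (rule seminormI_le)
  fix c :: real and x
  show "(SUP i\<in>I. p i (c *\<^sub>R x)) \<le> \<bar>c\<bar> * (SUP i\<in>I. p i x)"
  proof (rule cSUP_least[OF \<open>I \<noteq> {}\<close>])
    fix i assume i: "i \<in> I"
    show "p i (c *\<^sub>R x) \<le> \<bar>c\<bar> * (SUP i\<in>I. p i x)"
      using sn[OF i] cSUP_upper[OF i bdd] by (auto simp: seminorm_def intro: mult_left_mono)
  qed
next
  fix x y
  show "(SUP i\<in>I. p i (x + y)) \<le> (SUP i\<in>I. p i x) + (SUP i\<in>I. p i y)"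
  proof (rule cSUP_least[OF \<open>I \<noteq> {}\<close>])
    fix i assume i: "i \<in> I"
    have "p i (x + y) \<le> p i x + p i y"
      using sn[OF i] by (simp add: seminorm_def)
    also have "\<dots> \<le> (SUP i\<in>I. p i x) + (SUP i\<in>I. p i y)"
      by (intro add_mono cSUP_upper i bdd)
    finally show "p i (x + y) \<le> (SUP i\<in>I. p i x) + (SUP i\<in>I. p i y)" .
  qed
qed

lemma seminorm_scaled_norm:
  assumes "linear f" "0 \<le> a"
  shows "seminorm (\<lambda>x. a * norm (f x))"
proof -
  have "a * norm (f (x + y)) \<le> a * norm (f x) + a * norm (f y)" for x y
    unfolding distrib_left[symmetric] linear_add[OF assms(1)]
    by (intro mult_left_mono norm_triangle_ineq assms(2))
  then show ?thesis
    unfolding seminorm_def by (simp add: linear_cmul[OF assms(1)])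
qed

lemma is_norm_seminorm_add:
  fixes p q :: "'a::real_normed_vector \<Rightarrow> real"
  assumes "seminorm p" "seminorm q" and ge: "\<And>x. norm x \<le> p x + q x"
  shows "is_norm (\<lambda>x. p x + q x)"
proof -
  have "p 0 + q 0 = 0"
    using assms(1,2) unfolding seminorm_def by (metis abs_zero add_0 mult_zero_left scaleR_zero_left)
  moreover have "0 \<le> p x + q x" for x
    using ge[of x] norm_ge_zero[of x] by linarith
  moreover have "x = 0" if "p x + q x = 0" for x
    using ge[of x] that by simp
  moreover have "p (x + y) + q (x + y) \<le> p x + q x + (p y + q y)" for x y
    using assms(1,2) unfolding seminorm_def by (smt (verit))
  ultimately show ?thesis
    using assms(1,2) unfolding is_norm_def seminorm_def by (auto simp: distrib_left)
qed

lemma nondecreasing_ge1_pos: "nondecreasing_ge1 N \<Longrightarrow> 0 \<le> t \<Longrightarrow> 0 < N t"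
  unfolding nondecreasing_ge1_def by (metis less_le_trans zero_less_one)

section \<open>Evolution operators with compatible projectors\<close>

locale compatible_evolution =
  fixes U :: "real \<Rightarrow> real \<Rightarrow> ('a::banach) \<Rightarrow>\<^sub>L 'a"
    and P :: "real \<Rightarrow> 'a \<Rightarrow>\<^sub>L 'a"
  assumes evolution: "evolution_operator U"
    and projectors: "projector_family P"
    and compatible: "compatible_with P U"
begin

abbreviation Q where "Q \<equiv> complementary P"
abbreviation V where "V \<equiv> inverse_evolution U P"

lemma U_refl: "0 \<le> t \<Longrightarrow> U t t x = x"
  using evolution by (simp add: evolution_operator_def)

lemma U_trans: "0 \<le> r \<Longrightarrow> r \<le> s \<Longrightarrow> s \<le> t \<Longrightarrow> U t s (U s r x) = U t r x"
  using evolution unfolding evolution_operator_def by (metis blinfun_apply_blinfun_compose)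

lemma P_idem: "0 \<le> t \<Longrightarrow> P t (P t x) = P t x"
  using projectors unfolding projector_family_def by (metis blinfun_apply_blinfun_compose)

lemma invariant: "invariant_for P U"
  using compatible by (simp add: compatible_with_def)

lemma U_P: "0 \<le> s \<Longrightarrow> s \<le> t \<Longrightarrow> U t s (P s x) = P t (U t s x)"
  using invariant by (simp add: invariant_for_def)

lemma Q_apply: "Q t x = x - P t x"
  by (simp add: complementary_def blinfun.diff_left)

lemma U_Q: "0 \<le> s \<Longrightarrow> s \<le> t \<Longrightarrow> U t s (Q s x) = Q t (U t s x)"
  by (simp add: Q_apply blinfun.diff_right U_P)

lemma P_Q: "0 \<le> t \<Longrightarrow> P t (Q t x) = 0"
  by (simp add: Q_apply blinfun.diff_right P_idem)

lemma Q_P: "0 \<le> t \<Longrightarrow> Q t (P t x) = 0"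
  by (simp add: Q_apply P_idem)

lemma Q_idem: "0 \<le> t \<Longrightarrow> Q t (Q t x) = Q t x"
  by (simp add: Q_apply[of t "Q t x"] P_Q)

lemmas U_V_Q = inverse_evolution_identities(1)[OF projectors compatible]
  and V_U_Q = inverse_evolution_identities(2)[OF projectors compatible]

lemma Q_V: "0 \<le> s \<Longrightarrow> s \<le> t \<Longrightarrow> Q s (V t s (Q t x)) = V t s (Q t x)"
  using inverse_evolution_identities(3)[OF projectors compatible] by simp

text \<open>
  All algebraic properties of \<open>V\<close> follow from uniqueness of preimages in the range of \<open>Q\<close>.
\<close>

lemma V_eqI: "0 \<le> s \<Longrightarrow> s \<le> t \<Longrightarrow> Q s v = v \<Longrightarrow> U t s v = w \<Longrightarrow> V t s w = v"
  using V_U_Q[of s t v] by simp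

lemma V_refl: "0 \<le> t \<Longrightarrow> V t t (Q t x) = Q t x"
  by (rule V_eqI) (simp_all add: Q_idem U_refl)

lemma V_trans:
  assumes "0 \<le> r" "r \<le> s" "s \<le> t"
  shows "V s r (V t s (Q t x)) = V t r (Q t x)"
proof (rule V_eqI)
  have "U t s (U s r (V t r (Q t x))) = Q t x"
    using assms by (simp add: U_trans U_V_Q)
  moreover have "Q s (U s r (V t r (Q t x))) = U s r (V t r (Q t x))"
    using assms Q_V[of r t x] U_Q[of r s "V t r (Q t x)"] by simp
  ultimately show "U s r (V t r (Q t x)) = V t s (Q t x)"
    using assms by (metis V_eqI order_trans)
qed (use assms Q_V in auto)

lemma linear_V_Q:
  assumes "0 \<le> s" "s \<le> t"
  shows "linear (\<lambda>x. V t s (Q t x))"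
  using assms
  by (intro linearI V_eqI) (simp_all add: blinfun.add_right blinfun.scaleR_right Q_V U_V_Q)

section \<open>The trajectory seminorms\<close>

definition stable_seminorm :: "(real \<Rightarrow> real) \<Rightarrow> real \<Rightarrow> 'a \<Rightarrow> real" where
  "stable_seminorm h t x = (SUP \<tau>\<in>{t..}. h \<tau> / h t * norm (U \<tau> t (P t x)))"

definition unstable_seminorm :: "(real \<Rightarrow> real) \<Rightarrow> real \<Rightarrow> 'a \<Rightarrow> real" where
  "unstable_seminorm k t x = (SUP r\<in>{0..t}. k t / k r * norm (V t r (Q t x)))"

context
  fixes h k N :: "real \<Rightarrow> real"
  assumes h: "nondecreasing_ge1 h" and k: "nondecreasing_ge1 k"
    and stable: "\<And>t s x. 0 \<le> s \<Longrightarrow> s \<le> t \<Longrightarrow>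
      h t * norm (U t s (P s x)) \<le> N s * h s * norm (P s x)"
    and unstable: "\<And>t s x. 0 \<le> s \<Longrightarrow> s \<le> t \<Longrightarrow>
      k t * norm (Q s x) \<le> N t * k s * norm (U t s (Q s x))"
begin

lemma stable_term_le:
  assumes "0 \<le> t" "t \<le> \<tau>"
  shows "h \<tau> / h t * norm (U \<tau> t (P t x)) \<le> N t * norm (P t x)"
  using stable[OF assms] nondecreasing_ge1_pos[OF h assms(1)] by (simp add: field_simps)

text \<open>The unstable estimate is applied to \<open>V(t,r)Q(t)x\<close>, which \<open>U(t,r)\<close> maps back to \<open>Q(t)x\<close>.\<close>

lemma unstable_term_le:
  assumes "0 \<le> r" "r \<le> t"
  shows "k t / k r * norm (V t r (Q t x)) \<le> N t * norm (Q t x)"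
  using unstable[OF assms, of "V t r (Q t x)"] nondecreasing_ge1_pos[OF k assms(1)] assms
  by (simp add: Q_V U_V_Q field_simps)

lemma bdd_stable:
  "0 \<le> t \<Longrightarrow> bdd_above ((\<lambda>\<tau>. h \<tau> / h t * norm (U \<tau> t (P t x))) ` {t..})"
  by (rule bdd_aboveI2, rule stable_term_le) auto

lemma bdd_unstable: "bdd_above ((\<lambda>r. k t / k r * norm (V t r (Q t x))) ` {0..t})"
  by (rule bdd_aboveI2, rule unstable_term_le) auto

lemma stable_seminorm_le: "0 \<le> t \<Longrightarrow> stable_seminorm h t x \<le> N t * norm (P t x)"
  unfolding stable_seminorm_def by (rule cSUP_least) (auto intro: stable_term_le simp del: times_divide_eq_left)

lemma unstable_seminorm_le: "0 \<le> t \<Longrightarrow> unstable_seminorm k t x \<le> N t * norm (Q t x)"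
  unfolding unstable_seminorm_def by (rule cSUP_least) (auto intro: unstable_term_le simp del: times_divide_eq_left)

lemma stable_seminorm_ge:
  "0 \<le> t \<Longrightarrow> t \<le> \<tau> \<Longrightarrow> h \<tau> / h t * norm (U \<tau> t (P t x)) \<le> stable_seminorm h t x"
  unfolding stable_seminorm_def by (rule cSUP_upper[OF _ bdd_stable]) auto

lemma unstable_seminorm_ge:
  "0 \<le> r \<Longrightarrow> r \<le> t \<Longrightarrow> k t / k r * norm (V t r (Q t x)) \<le> unstable_seminorm k t x"
  unfolding unstable_seminorm_def by (rule cSUP_upper[OF _ bdd_unstable]) auto

lemma norm_le_seminorms:
  assumes "0 \<le> t"
  shows "norm x \<le> stable_seminorm h t x + unstable_seminorm k t x"
proof -
  have "norm x \<le> norm (P t x) + norm (Q t x)"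
    using norm_triangle_ineq[of "P t x" "Q t x"] by (simp add: Q_apply)
  moreover have "norm (P t x) \<le> stable_seminorm h t x"
    using stable_seminorm_ge[of t t x] nondecreasing_ge1_pos[OF h assms] assms
    by (simp add: U_refl)
  moreover have "norm (Q t x) \<le> unstable_seminorm k t x"
    using unstable_seminorm_ge[of t t x] nondecreasing_ge1_pos[OF k assms] assms
    by (simp add: V_refl)
  ultimately show ?thesis
    by linarith
qed

lemma is_norm_trajectory:
  assumes "0 \<le> t"
  shows "is_norm (\<lambda>x. stable_seminorm h t x + unstable_seminorm k t x)"
proof (rule is_norm_seminorm_add)
  show "seminorm (stable_seminorm h t)"
    unfolding stable_seminorm_def
  proof (rule seminorm_SUP)
    fix \<tau> assume "\<tau> \<in> {t..}"
    then have "0 \<le> h \<tau> / h t"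
      using assms nondecreasing_ge1_pos[OF h, of \<tau>] nondecreasing_ge1_pos[OF h, of t] by simp
    then show "seminorm (\<lambda>x. h \<tau> / h t * norm (U \<tau> t (P t x)))"
      by (intro seminorm_scaled_norm linearI)
        (simp_all add: blinfun.add_right blinfun.scaleR_right)
  qed (use assms bdd_stable in auto)
  show "seminorm (unstable_seminorm k t)"
    unfolding unstable_seminorm_def
  proof (rule seminorm_SUP)
    fix r assume r: "r \<in> {0..t}"
    then have "0 \<le> k t / k r"
      using nondecreasing_ge1_pos[OF k, of r] nondecreasing_ge1_pos[OF k, of t] by simp
    with r show "seminorm (\<lambda>x. k t / k r * norm (V t r (Q t x)))"
      by (intro seminorm_scaled_norm linear_V_Q) auto
  qed (use assms bdd_unstable in auto)
qed (rule norm_le_seminorms[OF assms])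

lemma stable_seminorm_contracts:
  assumes "0 \<le> s" "s \<le> t"
  shows "h t * stable_seminorm h t (U t s (P s x)) \<le> h s * stable_seminorm h s (P s x)"
proof -
  have pos: "0 < h s" "0 < h t"
    using nondecreasing_ge1_pos[OF h] assms by auto
  have "stable_seminorm h t (U t s (P s x)) \<le> h s / h t * stable_seminorm h s (P s x)"
    unfolding stable_seminorm_def[of h t]
  proof (rule cSUP_least)
    fix \<tau> assume "\<tau> \<in> {t..}"
    then have \<tau>: "t \<le> \<tau>" by simp
    have "U \<tau> t (P t (U t s (P s x))) = U \<tau> s (P s (P s x))"
      using assms \<tau> by (simp add: U_P[symmetric] U_trans P_idem)
    moreover have "h \<tau> / h s * norm (U \<tau> s (P s (P s x))) \<le> stable_seminorm h s (P s x)"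
      using assms \<tau> by (intro stable_seminorm_ge) auto
    ultimately show "h \<tau> / h t * norm (U \<tau> t (P t (U t s (P s x))))
        \<le> h s / h t * stable_seminorm h s (P s x)"
      using pos by (simp add: field_simps)
  qed simp
  then show ?thesis
    using pos by (simp add: field_simps)
qed

lemma unstable_seminorm_contracts:
  assumes "0 \<le> s" "s \<le> t"
  shows "k t * unstable_seminorm k s (V t s (Q t x)) \<le> k s * unstable_seminorm k t (Q t x)"
proof -
  have pos: "0 < k s" "0 < k t"
    using nondecreasing_ge1_pos[OF k] assms by auto
  have "unstable_seminorm k s (V t s (Q t x)) \<le> k s / k t * unstable_seminorm k t (Q t x)"
    unfolding unstable_seminorm_def[of k s]
  proof (rule cSUP_least)
    fix r assume "r \<in> {0..s}"
    then have r: "0 \<le> r" "r \<le> s" by auto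
    have "V s r (Q s (V t s (Q t x))) = V t r (Q t (Q t x))"
      using assms r by (simp add: Q_V V_trans Q_idem)
    moreover have "k t / k r * norm (V t r (Q t (Q t x))) \<le> unstable_seminorm k t (Q t x)"
      using assms r by (intro unstable_seminorm_ge) auto
    ultimately show "k s / k r * norm (V s r (Q s (V t s (Q t x))))
        \<le> k s / k t * unstable_seminorm k t (Q t x)"
      using pos nondecreasing_ge1_pos[OF k r(1)] by (simp add: field_simps)
  qed (use assms in simp)
  then show ?thesis
    using pos by (simp add: field_simps)
qed

text \<open>
  The upper bounds vanish on the complementary ranges, so each contraction estimate for a single
  seminorm is also one for the sum.
\<close>

lemma trajectory_norm_contracts:
  assumes "0 \<le> s" "s \<le> t"
  defines "nrm \<equiv> \<lambda>t x. stable_seminorm h t x + unstable_seminorm k t x"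
  shows "h t * nrm t (U t s (P s x)) \<le> h s * nrm s (P s x)"
    and "k t * nrm s (V t s (Q t x)) \<le> k s * nrm t (Q t x)"
proof -
  have t: "0 \<le> t" using assms by simp
  have pos: "0 < h s" "0 < h t" "0 < k s" "0 < k t"
    using nondecreasing_ge1_pos[OF h] nondecreasing_ge1_pos[OF k] assms by auto
  have "Q t (U t s (P s x)) = 0"
    using assms(1,2) t by (simp add: U_P Q_P)
  then have "unstable_seminorm k t (U t s (P s x)) \<le> 0"
    using unstable_seminorm_le[OF t, of "U t s (P s x)"] by simp
  moreover have "0 \<le> unstable_seminorm k s (P s x)"
    using unstable_seminorm_ge[of s s "P s x"] assms(1) pos
    by (smt (verit) divide_pos_pos mult_nonneg_nonneg norm_ge_zero)
  ultimately show "h t * nrm t (U t s (P s x)) \<le> h s * nrm s (P s x)"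
    unfolding nrm_def distrib_left using stable_seminorm_contracts[OF assms(1,2), of x] pos
    by (smt (verit) mult_nonneg_nonneg mult_nonneg_nonpos)
  have "P s (V t s (Q t x)) = 0"
    using assms(1,2) P_Q[of s "V t s (Q t x)"] by (simp add: Q_V)
  then have "stable_seminorm h s (V t s (Q t x)) \<le> 0"
    using stable_seminorm_le[OF assms(1), of "V t s (Q t x)"] by simp
  moreover have "0 \<le> stable_seminorm h t (Q t x)"
    using stable_seminorm_ge[of t t "Q t x"] t pos
    by (smt (verit) divide_pos_pos mult_nonneg_nonneg norm_ge_zero)
  ultimately show "k t * nrm s (V t s (Q t x)) \<le> k s * nrm t (Q t x)"
    unfolding nrm_def distrib_left using unstable_seminorm_contracts[OF assms(1,2), of x] pos
    by (smt (verit) mult_nonneg_nonneg mult_nonneg_nonpos)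
qed

end

section \<open>The characterization\<close>

lemma dichotomic_imp_norms:
  assumes h: "nondecreasing_ge1 h" and k: "nondecreasing_ge1 k" and dich: "dichotomic h k U P"
  shows "\<exists>nrm. norm_family nrm \<and> norms_compatible_with nrm P \<and>
    (\<forall>t s x. 0 \<le> s \<and> s \<le> t \<longrightarrow>
      h t * nrm t (U t s (P s x)) \<le> h s * nrm s (P s x) \<and>
      k t * nrm s (V t s (Q t x)) \<le> k s * nrm t (Q t x))"
proof -
  from dich obtain N where N: "nondecreasing_ge1 N"
    and stable: "\<And>t s x. 0 \<le> s \<Longrightarrow> s \<le> t \<Longrightarrow>
      h t * norm (U t s (P s x)) \<le> N s * h s * norm (P s x)"
    and unstable: "\<And>t s x. 0 \<le> s \<Longrightarrow> s \<le> t \<Longrightarrow>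
      k t * norm (Q s x) \<le> N t * k s * norm (U t s (Q s x))"
    unfolding dichotomic_def by blast
  note est = h k stable unstable
  define nrm where "nrm = (\<lambda>t x. stable_seminorm h t x + unstable_seminorm k t x)"
  have "norm_family nrm"
    unfolding norm_family_def nrm_def using is_norm_trajectory[OF est] by blast
  moreover have "norms_compatible_with nrm P"
    unfolding norms_compatible_with_def
  proof (intro exI[of _ N] conjI allI impI N)
    fix t :: real and x
    assume t: "0 \<le> t"
    show "norm x \<le> nrm t x"
      unfolding nrm_def using norm_le_seminorms[OF est] t by blast
    show "nrm t x \<le> N t * (norm (P t x) + norm (Q t x))"
      unfolding nrm_def distrib_left
      by (intro add_mono stable_seminorm_le[OF est] unstable_seminorm_le[OF est] t)
  qed
  ultimately show ?thesis
    using trajectory_norm_contracts[OF est] unfolding nrm_def by blast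
qed

lemma norms_imp_dichotomic:
  assumes h: "nondecreasing_ge1 h" and k: "nondecreasing_ge1 k"
    and compat: "norms_compatible_with nrm P"
    and stable: "\<And>t s x. 0 \<le> s \<Longrightarrow> s \<le> t \<Longrightarrow>
      h t * nrm t (U t s (P s x)) \<le> h s * nrm s (P s x)"
    and unstable: "\<And>t s x. 0 \<le> s \<Longrightarrow> s \<le> t \<Longrightarrow>
      k t * nrm s (V t s (Q t x)) \<le> k s * nrm t (Q t x)"
  shows "dichotomic h k U P"
proof -
  from compat obtain N where N: "nondecreasing_ge1 N"
    and lower: "\<And>t x. 0 \<le> t \<Longrightarrow> norm x \<le> nrm t x"
    and upper: "\<And>t x. 0 \<le> t \<Longrightarrow> nrm t x \<le> N t * (norm (P t x) + norm (Q t x))"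
    unfolding norms_compatible_with_def by blast
  have "h t * norm (U t s (P s x)) \<le> N s * h s * norm (P s x)"
    and "k t * norm (Q s x) \<le> N t * k s * norm (U t s (Q s x))"
    if s: "0 \<le> s" and st: "s \<le> t" for t s x
  proof -
    have t: "0 \<le> t" using s st by simp
    have pos: "0 < h s" "0 < h t" "0 < k s" "0 < k t"
      using nondecreasing_ge1_pos[OF h] nondecreasing_ge1_pos[OF k] s t by auto
    have "h t * norm (U t s (P s x)) \<le> h t * nrm t (U t s (P s x))"
      using lower[OF t] pos by (intro mult_left_mono) auto
    also have "\<dots> \<le> h s * nrm s (P s x)"
      by (rule stable[OF s st])
    also have "\<dots> \<le> h s * (N s * norm (P s x))"
      using upper[OF s, of "P s x"] pos s by (intro mult_left_mono) (simp_all add: P_idem Q_P)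
    finally show "h t * norm (U t s (P s x)) \<le> N s * h s * norm (P s x)"
      by (simp add: ac_simps)
    have QU: "Q t (U t s (Q s x)) = U t s (Q s x)"
      using s st by (simp add: U_Q[symmetric] Q_idem)
    then have PU: "P t (U t s (Q s x)) = 0"
      by (simp add: Q_apply[of t "U t s (Q s x)"])
    have "k t * norm (Q s x) \<le> k t * nrm s (Q s x)"
      using lower[OF s] pos by (intro mult_left_mono) auto
    \<comment> \<open>The backward contraction is applied at the forward image of \<open>Q(s)x\<close>, which \<open>V(t,s)\<close> undoes.\<close>
    also have "\<dots> \<le> k s * nrm t (U t s (Q s x))"
      using unstable[OF s st, of "U t s (Q s x)"] s st by (simp add: QU V_U_Q)
    also have "\<dots> \<le> k s * (N t * norm (U t s (Q s x)))"
      using upper[OF t, of "U t s (Q s x)"] pos by (intro mult_left_mono) (simp_all add: QU PU)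
    finally show "k t * norm (Q s x) \<le> N t * k s * norm (U t s (Q s x))"
      by (simp add: ac_simps)
  qed
  with N invariant show ?thesis
    unfolding dichotomic_def by blast
qed

end

theorem theorem3p7:
  fixes U :: "real \<Rightarrow> real \<Rightarrow> ('a::banach) \<Rightarrow>\<^sub>L 'a"
    and P :: "real \<Rightarrow> 'a \<Rightarrow>\<^sub>L 'a"
    and h k :: "real \<Rightarrow> real"
  assumes "evolution_operator U"
    and "growth_rate h"
    and "growth_rate k"
    and "projector_family P"
    and "compatible_with P U"
  shows "dichotomic h k U P \<longleftrightarrow>
    (\<exists>nrm :: real \<Rightarrow> 'a \<Rightarrow> real.
       norm_family nrm \<and> norms_compatible_with nrm P \<and>
       (\<forall>t s x. 0 \<le> s \<and> s \<le> t \<longrightarrow>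
          h t * nrm t (U t s (P s x)) \<le> h s * nrm s (P s x) \<and>
          k t * nrm s (inverse_evolution U P t s (complementary P t x))
            \<le> k s * nrm t (complementary P t x)))"
proof -
  interpret compatible_evolution U P
    using assms by unfold_locales
  have hk: "nondecreasing_ge1 h" "nondecreasing_ge1 k"
    using assms by (simp_all add: growth_rate_def)
  show ?thesis
    using dichotomic_imp_norms[OF hk] norms_imp_dichotomic[OF hk] by blast
qed

end
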